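(* Let $\alpha>-1$ be a real number. If $f(x)=\sum_{k=0}^n a_k x^k\in\mathbb{R}[x]$ has all of its zeros in the interval $(-1,1)$, then the polynomial $$T[f](x)=\sum_{k=0}^n a_k\,\frac{k!}{\Gamma(k+1+\alpha)}\,P^{(\alpha,\alpha)}_k(x)$$ has all of its zeros in $(-1,1)$.
   Context: "All of its zeros" means all complex zeros; the assertion is that each of them is real and lies in the open interval $(-1,1)$. $\Gamma$ is the Gamma function. $P_n^{(\alpha,\beta)}(x)$ denotes the $n$-th Jacobi polynomial with parameters $\alpha,\beta$, defined by the generating function $$\frac{2^{\alpha+\beta}}{\rho(1+t+\rho)^{\beta}(1-t+\rho)^{\alpha}}=\sum_{n=0}^\infty P_n^{(\alpha,\beta)}(x)\,t^n,\qquad \rho=(1-2xt+t^2)^{1/2}.$$ The polynomials $P_n^{(\alpha,\alpha)}(x)$ are the ultraspherical polynomials. *)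

theory Defs
  imports "HOL-Analysis.Analysis"
begin

text \<open>
  The generating function of the Jacobi polynomials is read as a formal power series in \<open>t\<close>
  with coefficients in \<open>\<real>[x]\<close>, i.e. as an element of \<^typ>\<open>real poly fps\<close>; thus
  \<open>t\<close> is \<^term>\<open>fps_X\<close> and \<open>x\<close> is \<^term>\<open>fps_const [:0, 1:]\<close>.

  \<open>fps_powr F a\<close> is the power \<open>F\<^sup>a\<close> with a real exponent, given by the binomial series
  \<open>c\<^sup>a (1 + (F / c - 1))\<^sup>a\<close>. It is meaningful only if the coefficient of \<open>t\<^sup>0\<close>
  in \<open>F\<close> is a constant polynomial \<open>[:c:]\<close> with \<open>c > 0\<close>. This is the case for all series
  to which it is applied below: the constants are 1, 1, 2 and 2.
\<close>

definition fps_powr :: "real poly fps \<Rightarrow> real \<Rightarrow> real poly fps" where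
  "fps_powr F a =
     (let c = coeff (fps_nth F 0) 0
      in fps_const [:c powr a:] *
         fps_compose (Abs_fps (\<lambda>n. [:a gchoose n:])) (fps_const [:1 / c:] * F - 1))"

definition jacobi_rho :: "real poly fps" where
  "jacobi_rho = fps_powr (1 - 2 * fps_const [:0, 1:] * fps_X + fps_X\<^sup>2) (1 / 2)"

text \<open>
  There is no division on \<^typ>\<open>real poly fps\<close>, so the factors of the denominator appear with
  negated exponents; lemma \<open>jacobi_gf_eq\<close> below is the form with the denominator cleared.
\<close>

definition jacobi_gf :: "real \<Rightarrow> real \<Rightarrow> real poly fps" where
  "jacobi_gf \<alpha> \<beta> =
     fps_const [:2 powr (\<alpha> + \<beta>):] * fps_powr jacobi_rho (-1) *
     fps_powr (1 + fps_X + jacobi_rho) (- \<beta>) * fps_powr (1 - fps_X + jacobi_rho) (- \<alpha>)"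

definition jacobi_poly :: "nat \<Rightarrow> real \<Rightarrow> real \<Rightarrow> real poly" where
  "jacobi_poly n \<alpha> \<beta> = fps_nth (jacobi_gf \<alpha> \<beta>) n"

text \<open>The zero polynomial does not satisfy this predicate; nonzero constants do.\<close>

definition all_zeros_in_unit_interval :: "real poly \<Rightarrow> bool" where
  "all_zeros_in_unit_interval p \<longleftrightarrow>
     (\<forall>z::complex. poly (map_poly complex_of_real p) z = 0 \<longrightarrow>
        (\<exists>r::real. z = complex_of_real r \<and> -1 < r \<and> r < 1))"

lemma binomial_series_add:
  "Abs_fps (\<lambda>n. [:(a + b) gchoose n:] :: real poly) =
   Abs_fps (\<lambda>n. [:a gchoose n:]) * Abs_fps (\<lambda>n. [:b gchoose n:])"
proof (rule fps_ext)
  fix n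
  have "(a + b) gchoose n = (\<Sum>i=0..n. (a gchoose i) * (b gchoose (n - i)))"
    using arg_cong[OF fps_binomial_add_mult[of a b], of "\<lambda>F. fps_nth F n"]
    by (simp add: fps_mult_nth)
  moreover have "[:sum f A:] = (\<Sum>i\<in>A. [:f i:])" for f :: "nat \<Rightarrow> real" and A
    proof (induction A rule: infinite_finite_induct)
    case (insert i A)
    have "[:f i + sum f A:] = [:f i:] + [:sum f A:]" by simp
    with insert show ?case by (simp del: add_pCons)
  qed auto
  ultimately show "fps_nth (Abs_fps (\<lambda>n. [:(a + b) gchoose n:])) n =
    fps_nth (Abs_fps (\<lambda>n. [:a gchoose n:]) * Abs_fps (\<lambda>n. [:b gchoose n:])) n"
    by (simp add: fps_mult_nth mult.commute)
qed

lemma fps_powr_add: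
  assumes "fps_nth F 0 = [:c:]" "c > 0"
  shows "fps_powr F (a + b) = fps_powr F a * fps_powr F b"
proof -
  have "fps_nth (fps_const [:1 / c:] * F - 1) 0 = 0"
    using assms by (simp add: one_pCons)
  moreover have "[:c powr (a + b):] = [:c powr a:] * [:c powr b:]"
    by (simp add: powr_add)
  ultimately show ?thesis
    using assms
    by (simp only: fps_powr_def Let_def binomial_series_add fps_compose_mult_distrib
          fps_const_mult[symmetric] coeff_pCons_0 mult_ac)
qed

lemma fps_powr_0:
  assumes "fps_nth F 0 = [:c:]" "c > 0"
  shows "fps_powr F 0 = 1"
proof -
  have "Abs_fps (\<lambda>n. [:0 gchoose n:] :: real poly) = 1"
    by (rule fps_ext) (simp add: one_pCons gbinomial_0_left)
  thus ?thesis using assms by (simp add: fps_powr_def Let_def one_pCons[symmetric])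
qed

lemma fps_powr_1:
  assumes "fps_nth F 0 = [:c:]" "c > 0"
  shows "fps_powr F 1 = F"
proof -
  have *: "Abs_fps (\<lambda>n. [:1 gchoose n:] :: real poly) = 1 + fps_X"
  proof (rule fps_ext)
    fix n
    have "(1 :: real) gchoose n = of_nat (1 choose n)"
      using binomial_gbinomial[of 1 n, where 'a = real] by simp
    thus "fps_nth (Abs_fps (\<lambda>n. [:1 gchoose n:] :: real poly)) n = fps_nth (1 + fps_X) n"
      by (cases n rule: nat.exhaust; cases "n = 1") (auto simp: one_pCons binomial_eq_0)
  qed
  have "fps_nth (fps_const [:1 / c:] * F - 1) 0 = 0"
    using assms by (simp add: one_pCons)
  hence "fps_compose (1 + fps_X) (fps_const [:1 / c:] * F - 1) = fps_const [:1 / c:] * F"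
    by (simp add: fps_compose_add_distrib)
  moreover have "fps_const [:c:] * (fps_const [:1 / c:] * F) = F"
    using assms by (simp flip: mult.assoc add: one_pCons[symmetric])
  ultimately show ?thesis using assms
    by (simp add: fps_powr_def Let_def *)
qed

lemma fps_powr_nth_0:
  assumes "fps_nth F 0 = [:c:]" "c > 0"
  shows "fps_nth (fps_powr F a) 0 = [:c powr a:]"
  using assms by (simp add: fps_powr_def Let_def)

lemma jacobi_rho_nth_0: "fps_nth jacobi_rho 0 = [:1:]"
  unfolding jacobi_rho_def by (subst fps_powr_nth_0[where c = 1]) (auto simp: one_pCons)

lemma jacobi_rho_squared: "jacobi_rho\<^sup>2 = 1 - 2 * fps_const [:0, 1:] * fps_X + fps_X\<^sup>2"
proof -
  let ?F = "1 - 2 * fps_const [:0, 1:] * fps_X + fps_X\<^sup>2 :: real poly fps"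
  have F: "fps_nth ?F 0 = [:1:]" by (simp add: one_pCons)
  show ?thesis
    using fps_powr_add[OF F, of "1/2" "1/2"] fps_powr_1[OF F]
    by (simp add: jacobi_rho_def power2_eq_square)
qed

lemma jacobi_gf_eq:
  "jacobi_gf \<alpha> \<beta> *
     (jacobi_rho * fps_powr (1 + fps_X + jacobi_rho) \<beta> * fps_powr (1 - fps_X + jacobi_rho) \<alpha>) =
   fps_const [:2 powr (\<alpha> + \<beta>):]"
proof -
  let ?A = "1 + fps_X + jacobi_rho" and ?B = "1 - fps_X + jacobi_rho"
  have A: "fps_nth ?A 0 = [:2:]" and B: "fps_nth ?B 0 = [:2:]"
    by (simp_all add: jacobi_rho_nth_0 one_pCons)
  have "fps_powr jacobi_rho (-1) * jacobi_rho = 1"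
    using fps_powr_add[OF jacobi_rho_nth_0, of "-1" 1] fps_powr_1[OF jacobi_rho_nth_0]
          fps_powr_0[OF jacobi_rho_nth_0] by simp
  moreover have "fps_powr ?A (-\<beta>) * fps_powr ?A \<beta> = 1"
    using fps_powr_add[OF A, of "-\<beta>" \<beta>] fps_powr_0[OF A] by simp
  moreover have "fps_powr ?B (-\<alpha>) * fps_powr ?B \<alpha> = 1"
    using fps_powr_add[OF B, of "-\<alpha>" \<alpha>] fps_powr_0[OF B] by simp
  moreover have *: "(c * r' * a' * b') * (r * a * b) = c * (r' * r) * (a' * a) * (b' * b)"
    for c r' a' b' r a b :: "real poly fps" by (simp add: mult_ac)
  ultimately show ?thesis by (simp only: jacobi_gf_def * mult_1_right)
qed

end

theory Submission
  imports Defs "HOL-Computational_Algebra.Fundamental_Theorem_Algebra"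
begin

text \<open>
  Let \<open>(c)\<^sub>k\<close> be the Pochhammer symbol, \<open>D = d/dx\<close>, and let \<open>0F1\<close> and \<open>2F1\<close> be the
  hypergeometric series. The generating function gives
  \<open>P\<^sub>k = (\<alpha>+1)\<^sub>k \<Sum>\<^sub>j (x\<^sup>2 - 1)\<^sup>j x\<^sup>k\<^sup>-\<^sup>2\<^sup>j / (4\<^sup>j j! (\<alpha>+1)\<^sub>j (k - 2 j)!)\<close>
  (lemma \<open>poly_ultraspherical\<close>), and the weight \<open>k! / \<Gamma>(k+1+\<alpha>)\<close> is exactly the one that
  removes \<open>(\<alpha>+1)\<^sub>k\<close> and turns the monomials into derivatives of \<open>x\<^sup>k\<close>. Hence, up to the factor
  \<open>1 / \<Gamma>(\<alpha>+1)\<close>, the value of \<open>T[f]\<close> at a complex point \<open>z\<close> is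
  \<open>(J(w D) f)(z)\<close>, where \<open>J(u) = 0F1(; \<alpha>+1; - u\<^sup>2 / 4)\<close> and \<open>w\<^sup>2 = 1 - z\<^sup>2\<close>.

  For \<open>\<alpha> > -1\<close> the Bessel function \<open>J\<close> is a limit of even polynomials with only real zeros. On
  polynomials, \<open>J(w D)\<close> is therefore a limit of products of operators \<open>1 - b w D\<close> with real
  \<open>b\<close>. By the logarithmic derivative, such an operator keeps all roots in any closed half-plane
  whose boundary is parallel to \<open>w\<close> (lemma \<open>root_minus_pderiv_in_half_plane\<close>), and this
  survives the limit (theorem \<open>roots_bessel_op_in_half_plane\<close>). If the roots of \<open>f\<close> lie in
  \<open>[-k, k]\<close> with \<open>k < 1\<close>, a root \<open>z\<close> of \<open>T[f]\<close> must then lie in the strip \<open>[-k, k] + \<real> w\<close>.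

  So the complex number \<open>w\<close> may depend on the root \<open>z\<close> under consideration, and
  what is left is plane geometry: \<open>z\<^sup>2 + w\<^sup>2 = 1\<close> together with \<open>z \<in> [-k, k] + \<real> w\<close> forces \<open>z\<close> to
  be real and in \<open>(-1, 1)\<close> (lemma \<open>real_of_strip_and_circle\<close>). If \<open>w = 0\<close>, then
  \<open>T[f](z)\<close> is a multiple of \<open>f(z)\<close>, which is nonzero at \<open>z = \<plusminus>1\<close>.
\<close>

section \<open>Differential operators that keep roots in a half-plane\<close>

text \<open>
  \<open>p' / p\<close> at \<open>z\<close> is the sum of \<open>1 / (z - \<zeta>)\<close> over the roots \<open>\<zeta>\<close>, so a sign shared by
  all summands is the sign of the whole. The direction \<open>v\<close> selects the half-plane that
  contains the summands.
\<close>

lemma Im_log_derivative_neg: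
  fixes p :: "complex poly"
  assumes "degree p > 0" and "\<And>\<zeta>. poly p \<zeta> = 0 \<Longrightarrow> Im (v / (z - \<zeta>)) < 0"
  shows "Im (v * poly (pderiv p) z / poly p z) < 0"
  using assms
proof (induction "degree p" arbitrary: p rule: less_induct)
  case less
  obtain \<zeta> where \<zeta>: "poly p \<zeta> = 0"
    using less.prems(1) fundamental_theorem_of_algebra[of p] by (auto simp: constant_degree)
  then obtain q where p: "p = [:-\<zeta>, 1:] * q"
    by (auto simp: poly_eq_0_iff_dvd)
  have "q \<noteq> 0" using less.prems(1) p by auto
  then have deg: "degree p = Suc (degree q)"
    unfolding p by (subst degree_mult_eq) auto
  have neg: "Im (v / (z - \<zeta>)) < 0" using less.prems(2) \<zeta> by blast
  then have z: "z \<noteq> \<zeta>" by auto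
  have "poly p z \<noteq> 0"
    using less.prems(2)[of z] by auto
  then have qz: "poly q z \<noteq> 0" by (auto simp: p)
  have split: "v * poly (pderiv p) z / poly p z = v / (z - \<zeta>) + v * poly (pderiv q) z / poly q z"
  proof -
    have "poly (pderiv p) z = poly q z + (z - \<zeta>) * poly (pderiv q) z"
      unfolding p pderiv_mult by (simp add: pderiv_pCons algebra_simps)
    moreover have "poly p z = (z - \<zeta>) * poly q z" by (simp add: p algebra_simps)
    ultimately show ?thesis using z qz by (simp only:) (simp add: field_simps)
  qed
  show ?case
  proof (cases "degree q = 0")
    case True
    then have "pderiv q = 0" by (simp add: pderiv_eq_0_iff)
    then show ?thesis using neg by (simp add: split)
  next
    case False
    have "Im (v * poly (pderiv q) z / poly q z) < 0"
      using False deg less.prems(2) by (intro less.hyps) (auto simp: p)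
    then show ?thesis using neg by (simp add: split)
  qed
qed

text \<open>
  At a root \<open>z\<close> of \<open>p - b w p'\<close> with \<open>p(z) \<noteq> 0\<close> the number \<open>w p'(z) / p(z) = 1 / b\<close> is real.
  If \<open>z\<close> lay outside the half-plane, every \<open>w / (z - \<zeta>)\<close> would point strictly into the lower
  half-plane. The boundary of the half-plane is parallel to \<open>w\<close>: shifts by real multiples of
  \<open>w\<close> do not cross it, and for this reason both signs of \<open>b\<close> are harmless.
\<close>

lemma root_minus_pderiv_in_half_plane:
  fixes p :: "complex poly"
  assumes "p \<noteq> 0" and roots: "\<And>\<zeta>. poly p \<zeta> = 0 \<Longrightarrow> Im (cnj w * \<zeta>) \<le> c"
    and z: "poly (p - smult (of_real b * w) (pderiv p)) z = 0"
  shows "Im (cnj w * z) \<le> c"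
proof (rule ccontr)
  assume "\<not> Im (cnj w * z) \<le> c"
  then have c: "c < Im (cnj w * z)" by simp
  have neg: "Im (w / (z - \<zeta>)) < 0" if "poly p \<zeta> = 0" for \<zeta>
  proof -
    have lt: "Im (cnj w * \<zeta>) < Im (cnj w * z)" using roots[OF that] c by simp
    then have "z \<noteq> \<zeta>" by auto
    then have pos: "norm (z - \<zeta>) ^ 2 > 0" by simp
    have "Im (w / (z - \<zeta>)) = (Im (cnj w * \<zeta>) - Im (cnj w * z)) / norm (z - \<zeta>) ^ 2"
      by (simp add: Im_divide cmod_power2 algebra_simps)
    then show ?thesis using lt pos by (simp add: divide_neg_pos)
  qed
  have pz: "poly p z \<noteq> 0" using neg[of z] by auto
  show False
  proof (cases "degree p = 0")
    case True
    then have "pderiv p = 0" by (simp add: pderiv_eq_0_iff)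
    then show False using z pz by simp
  next
    case False
    have "poly p z = of_real b * w * poly (pderiv p) z" using z by simp
    then have "of_real b * (w * poly (pderiv p) z / poly p z) = 1"
      using pz by (simp add: field_simps)
    then have "b * Im (w * poly (pderiv p) z / poly p z) = 0"
      by (metis Im_complex_of_real Re_complex_of_real add.right_neutral mult_zero_left of_real_1
          times_complex.sel(2))
    moreover have "b \<noteq> 0" using \<open>of_real b * _ = 1\<close> by auto
    ultimately show False
      using Im_log_derivative_neg[of p w z] False neg by auto
  qed
qed

text \<open>
  With \<open>D = d/dx\<close> this is \<open>q(v\<^sup>2 D\<^sup>2) p\<close>. Higher terms of \<open>q\<close> annihilate \<open>p\<close>; cutting the sum
  at \<open>degree p\<close> gives the same number of terms for all \<open>q\<close>, so that limits in \<open>q\<close> are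
  limits of finite sums.
\<close>

definition even_diff_op :: "complex \<Rightarrow> complex poly \<Rightarrow> complex poly \<Rightarrow> complex poly" where
  "even_diff_op v q p = (\<Sum>i\<le>degree p. smult (coeff q i * v ^ (2 * i)) ((pderiv ^^ (2 * i)) p))"

lemma smult_sum_right: "smult c (\<Sum>i\<in>A. f i) = (\<Sum>i\<in>A. smult c (f i))"
  by (induction A rule: infinite_finite_induct) (auto simp: smult_add_right)

lemma higher_pderiv_eq_0:
  fixes p :: "'a :: {comm_semiring_1,semiring_no_zero_divisors,semiring_char_0} poly"
  assumes "degree p < n"
  shows "(pderiv ^^ n) p = 0"
  using assms
proof (induction n arbitrary: p)
  case (Suc n)
  show ?case
  proof (cases "degree p = 0")
    case True
    then have "pderiv p = 0" by (simp add: pderiv_eq_0_iff)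
    then show ?thesis by (simp add: funpow_Suc_right del: funpow.simps)
  next
    case False
    then show ?thesis using Suc by (simp add: funpow_Suc_right degree_pderiv del: funpow.simps)
  qed
qed auto

lemma even_diff_op_linear_factor:
  "even_diff_op v ([:-r, 1:] * q) p =
   smult (v\<^sup>2) (pderiv (pderiv (even_diff_op v q p))) - smult r (even_diff_op v q p)"
proof -
  let ?n = "degree p"
  let ?g = "\<lambda>i. smult (coeff q i * v ^ (2 * i)) ((pderiv ^^ (2 * i)) p)"
  let ?h = "\<lambda>i. smult (v\<^sup>2) (pderiv (pderiv (?g i)))"
  have h: "?h i = smult (coeff q i * v ^ (2 * Suc i)) ((pderiv ^^ (2 * Suc i)) p)" for i
    by (simp add: pderiv_smult power2_eq_square mult_ac)
  have top: "?h ?n = 0"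
    unfolding h by (subst higher_pderiv_eq_0) auto
  have D: "smult (v\<^sup>2) (pderiv (pderiv (even_diff_op v q p))) = (\<Sum>i\<le>?n. ?h i)"
    by (simp only: even_diff_op_def higher_pderiv_sum[where n = 1, simplified] smult_sum_right)
  also have "\<dots> = (\<Sum>i<?n. ?h i)"
    using top by (simp flip: lessThan_Suc_atMost)
  also have "\<dots> = (\<Sum>i\<le>?n. smult (coeff (pCons 0 q) i * v ^ (2 * i)) ((pderiv ^^ (2 * i)) p))"
    unfolding h lessThan_Suc_atMost[symmetric] sum.lessThan_Suc_shift by simp
  finally have D: "smult (v\<^sup>2) (pderiv (pderiv (even_diff_op v q p))) = even_diff_op v (pCons 0 q) p"
    by (simp only: even_diff_op_def)
  have eq: "[:-r, 1:] * q = pCons 0 q - smult r q" by simp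
  show ?thesis
    unfolding D eq
    by (simp add: even_diff_op_def smult_sum_right sum_subtractf[symmetric] smult_diff_left[symmetric]
        algebra_simps)
qed

lemma
  shows degree_even_diff_op_le: "degree (even_diff_op v q p) \<le> degree p"
    and coeff_degree_even_diff_op: "coeff (even_diff_op v q p) (degree p) = coeff q 0 * lead_coeff p"
proof -
  show "degree (even_diff_op v q p) \<le> degree p"
    unfolding even_diff_op_def
    by (intro degree_sum_le) (auto intro!: order.trans[OF degree_smult_le] simp: degree_higher_pderiv)
  have z: "coeff ((pderiv ^^ (2 * i)) p) (degree p) = 0" if "i \<noteq> 0" for i
  proof (cases "degree p = 0")
    case True
    then show ?thesis using that by (simp add: higher_pderiv_eq_0)
  next
    case False
    then show ?thesis using that by (intro coeff_eq_0) (simp add: degree_higher_pderiv)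
  qed
  have "coeff (even_diff_op v q p) (degree p) =
      (\<Sum>i\<le>degree p. if i = 0 then coeff q 0 * lead_coeff p else 0)"
    unfolding even_diff_op_def coeff_sum by (intro sum.cong) (auto simp: z)
  then show "coeff (even_diff_op v q p) (degree p) = coeff q 0 * lead_coeff p"
    by simp
qed

text \<open>
  A factor \<open>v\<^sup>2 D\<^sup>2 - r\<close> with \<open>v = b w\<close> and \<open>r > 0\<close> splits as
  \<open>- r (1 - \<beta> w D) (1 + \<beta> w D)\<close> with the real number \<open>\<beta> = b / sqrt r\<close>. This is where the
  positivity of the roots of \<open>q\<close> enters.
\<close>

lemma roots_even_diff_op_in_half_plane:
  fixes p q :: "complex poly" and w :: complex and b c :: real
  assumes "p \<noteq> 0" and p: "\<And>\<zeta>. poly p \<zeta> = 0 \<Longrightarrow> Im (cnj w * \<zeta>) \<le> c"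
    and "q \<noteq> 0" and "\<And>s. poly q s = 0 \<Longrightarrow> \<exists>r>0. s = of_real r"
    and "poly (even_diff_op (of_real b * w) q p) z = 0"
  shows "Im (cnj w * z) \<le> c"
  using assms(3-5)
proof (induction "degree q" arbitrary: q z rule: less_induct)
  case less
  show ?case
  proof (cases "degree q = 0")
    case True
    then obtain k where q: "q = [:k:]" by (metis degree_eq_zeroE)
    then have k: "k \<noteq> 0" using less.prems by simp
    have "even_diff_op (of_real b * w) q p = (\<Sum>i\<le>degree p. if i = 0 then smult k p else 0)"
      unfolding even_diff_op_def q by (intro sum.cong) (auto simp: coeff_pCons split: nat.split)
    then have "even_diff_op (of_real b * w) q p = smult k p" by simp
    then show ?thesis using less.prems(3) k p by simp
  next
    case False
    then obtain s where s: "poly q s = 0"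
      using fundamental_theorem_of_algebra[of q] by (auto simp: constant_degree)
    then obtain r where r: "r > 0" "s = of_real r" using less.prems(2) by blast
    obtain q' where q: "q = [:-s, 1:] * q'"
      using s by (auto simp: poly_eq_0_iff_dvd)
    have q'0: "q' \<noteq> 0" using less.prems(1) q by auto
    then have deg: "degree q = Suc (degree q')"
      unfolding q by (subst degree_mult_eq) auto
    let ?v = "of_real b * w"
    define P where "P = even_diff_op ?v q' p"
    have IH: "Im (cnj w * \<zeta>) \<le> c" if "poly P \<zeta> = 0" for \<zeta>
      using less.hyps[of q' \<zeta>] deg q'0 less.prems(2) that by (auto simp: q P_def)
    have q'0': "coeff q' 0 \<noteq> 0"
    proof
      assume "coeff q' 0 = 0"
      then have "poly q 0 = 0" by (simp add: q poly_0_coeff_0)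
      then show False using less.prems(2) by fastforce
    qed
    have "P \<noteq> 0"
      using coeff_degree_even_diff_op[of ?v q' p] q'0' \<open>p \<noteq> 0\<close> by (auto simp: P_def)
    define \<beta> where "\<beta> = b / sqrt r"
    define P1 where "P1 = P - smult (of_real \<beta> * w) (pderiv P)"
    have P1: "Im (cnj w * \<zeta>) \<le> c" if "poly P1 \<zeta> = 0" for \<zeta>
      using root_minus_pderiv_in_half_plane[of P w c \<beta> \<zeta>] IH \<open>P \<noteq> 0\<close> that by (simp add: P1_def)
    have "P1 \<noteq> 0"
    proof
      assume "P1 = 0"
      then have *: "P = smult (of_real \<beta> * w) (pderiv P)" by (simp add: P1_def)
      have "degree P \<le> degree (pderiv P)" by (subst *) (rule degree_smult_le)
      then have "degree P = 0" by (simp add: degree_pderiv)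
      then have "pderiv P = 0" by (simp add: pderiv_eq_0_iff)
      then show False using * \<open>P \<noteq> 0\<close> by simp
    qed
    have sq: "(of_real \<beta>)\<^sup>2 * of_real r = (of_real b :: complex)\<^sup>2"
    proof -
      have "\<beta>\<^sup>2 * r = b\<^sup>2" using r by (simp add: \<beta>_def power_divide)
      then show ?thesis by (metis of_real_mult of_real_power)
    qed
    have sq2: "(of_real b :: complex)\<^sup>2 * w\<^sup>2 = of_real r * (of_real \<beta> * w * (of_real \<beta> * w))"
      unfolding sq[symmetric] by (simp add: power2_eq_square)
    have "even_diff_op ?v q p = smult (?v\<^sup>2) (pderiv (pderiv P)) - smult (of_real r) P"
      unfolding q r(2) P_def by (rule even_diff_op_linear_factor)
    also have "\<dots> = smult (- of_real r) (P1 - smult (of_real (- \<beta>) * w) (pderiv P1))"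
      by (simp add: P1_def pderiv_diff pderiv_smult smult_diff_right smult_add_right
          power_mult_distrib sq2)
    finally have "poly (P1 - smult (of_real (- \<beta>) * w) (pderiv P1)) z = 0"
      using less.prems(3) r(1) by simp
    then show ?thesis
      using root_minus_pderiv_in_half_plane[of P1 w c "-\<beta>" z] P1 \<open>P1 \<noteq> 0\<close> by blast
  qed
qed

text \<open>
  A quantitative form of having no roots beyond the boundary line. Only the degree and the
  leading coefficient of \<open>p\<close> occur, so the bound passes to limits of polynomials for which
  these two stay fixed. It takes the place of a theorem on the continuity of roots.
\<close>

lemma norm_poly_ge_power_of_depth:
  fixes p :: "complex poly"
  assumes "\<And>\<zeta>. poly p \<zeta> = 0 \<Longrightarrow> Im (cnj w * \<zeta>) \<le> c" and "c \<le> Im (cnj w * z)"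
  shows "norm (lead_coeff p) * (Im (cnj w * z) - c) ^ degree p \<le> norm w ^ degree p * norm (poly p z)"
proof (cases "p = 0")
  case False
  obtain root where p: "smult (lead_coeff p) (\<Prod>i<degree p. [:- root i, 1:]) = p"
    by (rule complex_poly_decompose')
  have pz: "poly p x = lead_coeff p * (\<Prod>i<degree p. x - root i)" for x
    by (subst p[symmetric]) (simp add: poly_prod del: p)
  have root: "Im (cnj w * root i) \<le> c" if "i < degree p" for i
    using that by (intro assms(1)) (auto simp: pz)
  have "(Im (cnj w * z) - c) ^ degree p = (\<Prod>i<degree p. Im (cnj w * z) - c)" by simp
  also have "\<dots> \<le> (\<Prod>i<degree p. norm w * norm (z - root i))"
  proof (intro prod_mono conjI)
    fix i assume "i \<in> {..<degree p}"
    then have "Im (cnj w * z) - c \<le> Im (cnj w * (z - root i))"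
      using root[of i] by (simp add: algebra_simps)
    also have "\<dots> \<le> norm (cnj w * (z - root i))" using abs_Im_le_cmod by (meson abs_le_D1)
    finally show "Im (cnj w * z) - c \<le> norm w * norm (z - root i)"
      by (simp add: norm_mult)
  qed (use assms(2) in simp)
  also have "\<dots> = norm w ^ degree p * norm (\<Prod>i<degree p. z - root i)"
    by (simp add: prod.distrib prod_norm)
  finally have "norm (lead_coeff p) * (Im (cnj w * z) - c) ^ degree p \<le>
      norm (lead_coeff p) * (norm w ^ degree p * norm (\<Prod>i<degree p. z - root i))"
    by (intro mult_left_mono) auto
  then show ?thesis by (simp add: pz[of z] norm_mult mult_ac)
qed auto

text \<open>
  The operator \<open>1 + c\<^sup>-\<^sup>1 s d/ds\<close> multiplies the coefficient of \<open>s\<^sup>j\<close> by \<open>1 + j / c\<close>. A root \<open>s\<close>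
  of the image satisfies \<open>s q'(s) / q(s) = - c\<close>, while the summands \<open>s / (s - r)\<close> with \<open>r > 0\<close>
  have imaginary part of the sign of \<open>- Im s\<close>, and are positive if \<open>s\<close> is negative.
\<close>

lemma euler_op_positive_roots:
  fixes q :: "complex poly" and c :: real
  assumes "c > 0" and "q \<noteq> 0" and roots: "\<And>s. poly q s = 0 \<Longrightarrow> \<exists>r>0. s = of_real r"
    and s: "poly (q + smult (of_real (1 / c)) (pCons 0 (pderiv q))) s = 0"
  shows "\<exists>r>0. s = of_real r"
proof (rule ccontr)
  assume neg: "\<not> ?thesis"
  then have qs: "poly q s \<noteq> 0" using roots by blast
  have s0: "s \<noteq> 0" using s qs by auto
  have "degree q > 0"
  proof (rule ccontr)
    assume "\<not> degree q > 0"
    then have "pderiv q = 0" by (simp add: pderiv_eq_0_iff)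
    then show False using s qs by simp
  qed
  have eq: "s * poly (pderiv q) s / poly q s = - of_real c"
    using s qs \<open>c > 0\<close> by (simp add: field_simps add_eq_0_iff)
  consider "Im s > 0" | "Im s < 0" | "Im s = 0" by linarith
  then show False
  proof cases
    case 1
    have "Im (s / (s - \<zeta>)) < 0" if \<zeta>: "poly q \<zeta> = 0" for \<zeta>
    proof -
      obtain r where r: "r > 0" "\<zeta> = of_real r" using roots[OF \<zeta>] by blast
      have "s \<noteq> \<zeta>" using qs \<zeta> by auto
      then have pos: "norm (s - \<zeta>) ^ 2 > 0" by simp
      have "Im (s / (s - \<zeta>)) = - (r * Im s) / norm (s - \<zeta>) ^ 2"
        by (simp add: r Im_divide cmod_power2 algebra_simps)
      then show ?thesis using pos 1 r by (simp add: divide_neg_pos)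
    qed
    then have "Im (s * poly (pderiv q) s / poly q s) < 0"
      by (rule Im_log_derivative_neg[OF \<open>degree q > 0\<close>])
    then show False by (simp add: eq)
  next
    case 2
    have "Im (- s / (s - \<zeta>)) < 0" if \<zeta>: "poly q \<zeta> = 0" for \<zeta>
    proof -
      obtain r where r: "r > 0" "\<zeta> = of_real r" using roots[OF \<zeta>] by blast
      have "s \<noteq> \<zeta>" using qs \<zeta> by auto
      then have pos: "norm (s - \<zeta>) ^ 2 > 0" by simp
      have "Im (- s / (s - \<zeta>)) = (r * Im s) / norm (s - \<zeta>) ^ 2"
        by (simp add: r Im_divide cmod_power2 algebra_simps)
      then show ?thesis using pos 2 r by (simp add: divide_neg_pos mult_pos_neg)
    qed
    then have "Im (- s * poly (pderiv q) s / poly q s) < 0"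
      by (rule Im_log_derivative_neg[OF \<open>degree q > 0\<close>])
    then show False using eq by simp
  next
    case 3
    then have sr: "s = of_real (Re s)" by (simp add: complex_eq_iff)
    then have Re: "Re s < 0" using neg s0 by (metis linorder_neqE_linordered_idom of_real_0)
    \<comment> \<open>The summands are positive reals here; the factor \<open>- \<i>\<close> turns them into the lower half-plane.\<close>
    have "Im (- \<i> * s / (s - \<zeta>)) < 0" if \<zeta>: "poly q \<zeta> = 0" for \<zeta>
    proof -
      obtain r where r: "r > 0" "\<zeta> = of_real r" using roots[OF \<zeta>] by blast
      have "- \<i> * s / (s - \<zeta>) = - \<i> * of_real (Re s / (Re s - r))"
        by (subst (1 2) sr) (simp add: r)
      moreover have "Re s / (Re s - r) > 0" using Re r by (simp add: divide_neg_neg)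
      ultimately show ?thesis by simp
    qed
    then have "Im (- \<i> * s * poly (pderiv q) s / poly q s) < 0"
      by (rule Im_log_derivative_neg[OF \<open>degree q > 0\<close>])
    moreover have "- \<i> * s * poly (pderiv q) s / poly q s = \<i> * of_real c"
      using arg_cong[OF eq, of "\<lambda>x. - \<i> * x"] by (simp add: mult_ac)
    ultimately have "Im (\<i> * of_real c) < 0" by (simp only:)
    then show False using \<open>c > 0\<close> by simp
  qed
qed

section \<open>The Bessel operator\<close>

text \<open>
  This polynomial is \<open>2F1(-N, a+1+m; a+1; s)\<close>. It is built from \<open>(1 - s)\<^sup>N\<close> by Euler operators
  so that its roots are visibly positive. For \<open>m = N\<close> and \<open>s = u\<^sup>2 / (4 N\<^sup>2)\<close> its coefficients
  tend to those of the Bessel series \<open>0F1(; a+1; - u\<^sup>2 / 4)\<close>.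
\<close>

primrec bessel_approx :: "real \<Rightarrow> nat \<Rightarrow> nat \<Rightarrow> complex poly" where
  "bessel_approx a N 0 = [:1, -1:] ^ N"
| "bessel_approx a N (Suc m) =
     bessel_approx a N m
       + smult (of_real (1 / (a + 1 + real m))) (pCons 0 (pderiv (bessel_approx a N m)))"

lemma coeff_bessel_approx:
  assumes "a > -1"
  shows "coeff (bessel_approx a N m) j =
    of_real ((-1) ^ j * real (N choose j) *
      (pochhammer (a + 1 + real m) j / pochhammer (a + 1) j))"
proof (induction m)
  case 0
  have nz: "pochhammer (a + 1) j \<noteq> 0"
    using assms pochhammer_pos[of "a + 1" j] by simp
  show ?case
  proof (cases "j \<le> N")
    case True
    then show ?thesis using nz by (simp add: coeff_linear_poly_power)
  next
    case False
    have "degree ([:1, -1:] ^ N :: complex poly) \<le> 1 * N"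
      by (rule order.trans[OF degree_power_le]) simp
    then show ?thesis using False by (simp add: coeff_eq_0)
  qed
next
  case (Suc m)
  define x where "x = a + 1 + real m"
  have x: "x > 0" using assms by (simp add: x_def)
  have rec: "(x + real j) * pochhammer x j = x * pochhammer (x + 1) j"
    using pochhammer_rec[of x j] pochhammer_rec'[of x j] by simp
  have X: "coeff (pCons 0 (pderiv p)) j = of_nat j * coeff p j" for p :: "complex poly"
    by (cases j) (simp_all add: coeff_pderiv)
  have "coeff (bessel_approx a N (Suc m)) j =
      of_real (1 + real j / x) * coeff (bessel_approx a N m) j"
    unfolding bessel_approx.simps coeff_add coeff_smult X x_def[symmetric]
    by (simp add: algebra_simps)
  also have "\<dots> = of_real ((1 + real j / x) * ((-1) ^ j * real (N choose j) *
      (pochhammer x j / pochhammer (a + 1) j)))"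
    by (simp only: Suc.IH of_real_mult x_def)
  also have "(1 + real j / x) * ((-1) ^ j * real (N choose j) *
      (pochhammer x j / pochhammer (a + 1) j)) =
      (-1) ^ j * real (N choose j) * ((((x + real j) * pochhammer x j) / x) / pochhammer (a + 1) j)"
    using x by (simp add: field_simps)
  also have "((x + real j) * pochhammer x j) / x = pochhammer (x + 1) j"
    using x by (simp add: rec)
  also have "x + 1 = a + 1 + real (Suc m)" by (simp add: x_def)
  finally show ?case .
qed

lemma bessel_approx_roots:
  assumes "a > -1"
  shows "bessel_approx a N m \<noteq> 0"
    and "poly (bessel_approx a N m) s = 0 \<Longrightarrow> \<exists>r>0. s = of_real r"
proof -
  have nz: "bessel_approx a N k \<noteq> 0" for k
  proof -
    have "coeff (bessel_approx a N k) 0 = 1"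
      by (simp add: coeff_bessel_approx[OF assms])
    then show ?thesis by auto
  qed
  then show "bessel_approx a N m \<noteq> 0" .
  show "\<exists>r>0. s = of_real r" if "poly (bessel_approx a N m) s = 0"
    using that
  proof (induction m arbitrary: s)
    case 0
    then have "s = of_real 1" by (simp split: if_splits)
    then show ?case using zero_less_one by blast
  next
    case (Suc m)
    show ?case
      by (rule euler_op_positive_roots[of "a + 1 + real m" "bessel_approx a N m"])
         (use assms Suc nz in auto)
  qed
qed

lemma tendsto_pochhammer_over_power:
  fixes c :: real
  shows "(\<lambda>N. pochhammer (c + real N) j / real N ^ j) \<longlonglongrightarrow> 1"
proof (induction j)
  case (Suc j)
  have "(\<lambda>N. (c + real j) * inverse (real N) + 1) \<longlonglongrightarrow> (c + real j) * 0 + 1"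
    by (intro tendsto_intros lim_inverse_n)
  moreover have "\<forall>\<^sub>F N in sequentially. (c + real j) * inverse (real N) + 1 = (c + real N + real j) / real N"
    using eventually_gt_at_top[of 0] by eventually_elim (simp add: field_simps)
  ultimately have "(\<lambda>N. (c + real N + real j) / real N) \<longlonglongrightarrow> 1"
    by (simp add: Lim_transform_eventually)
  from tendsto_mult[OF this Suc] show ?case
    by (simp add: pochhammer_Suc mult_ac)
qed auto

lemma tendsto_choose_over_power: "(\<lambda>N. real (N choose j) / real N ^ j) \<longlonglongrightarrow> 1 / fact j"
proof -
  have "real (N choose j) / real N ^ j = 1 / fact j * (pochhammer (1 - real j + real N) j / real N ^ j)"
    for N
    by (simp add: binomial_gbinomial gbinomial_pochhammer' algebra_simps)
  then show ?thesis
    using tendsto_mult[OF tendsto_const[of "1 / fact j"] tendsto_pochhammer_over_power[of "1 - real j" j]]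
    by simp
qed

text \<open>
  The factor \<open>N\<^sup>-\<^sup>2\<^sup>j\<close> from the rescaling is shared between the binomial coefficient and the
  Pochhammer symbol, each of which grows like \<open>N\<^sup>j\<close>.
\<close>

lemma tendsto_bessel_approx:
  assumes "a > -1"
  shows "(\<lambda>N. coeff (bessel_approx a N N) j * (of_real (1 / (2 * real N)) * w) ^ (2 * j))
    \<longlonglongrightarrow> (- w\<^sup>2) ^ j / of_real (4 ^ j * fact j * pochhammer (a + 1) j)"
proof -
  let ?P = "pochhammer (a + 1) j"
  let ?g = "\<lambda>N. (real (N choose j) / real N ^ j) * (pochhammer (a + 1 + real N) j / real N ^ j)"
  have "?g \<longlonglongrightarrow> 1 / fact j * 1"
    by (intro tendsto_mult tendsto_choose_over_power tendsto_pochhammer_over_power)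
  from tendsto_divide[OF this tendsto_const[of "4 ^ j * ?P"]]
  have "(\<lambda>N. ?g N / (4 ^ j * ?P)) \<longlonglongrightarrow> 1 / fact j * 1 / (4 ^ j * ?P)"
    using assms pochhammer_pos[of "a + 1" j] by simp
  from tendsto_mult[OF tendsto_const[of "(- w\<^sup>2) ^ j"] tendsto_of_real[OF this]]
  have "(\<lambda>N. (- w\<^sup>2) ^ j * of_real (?g N / (4 ^ j * ?P))) \<longlonglongrightarrow>
      (- w\<^sup>2) ^ j * of_real (1 / fact j * 1 / (4 ^ j * ?P))" .
  moreover have "coeff (bessel_approx a N N) j * (of_real (1 / (2 * real N)) * w) ^ (2 * j)
      = (- w\<^sup>2) ^ j * of_real (?g N / (4 ^ j * ?P))" for N
  proof -
    have "coeff (bessel_approx a N N) j * (of_real (1 / (2 * real N)) * w) ^ (2 * j) =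
       ((-1) ^ j * (w\<^sup>2) ^ j) * of_real (real (N choose j) *
        (pochhammer (a + 1 + real N) j / ?P) * ((1 / (2 * real N))\<^sup>2) ^ j)"
      unfolding coeff_bessel_approx[OF assms] power_mult_distrib power_mult by simp
    also have "(-1) ^ j * (w\<^sup>2) ^ j = (- w\<^sup>2) ^ j"
      by (simp flip: power_mult_distrib)
    also have "((1 / (2 * real N))\<^sup>2) ^ j = 1 / (4 ^ j * real N ^ j * real N ^ j)"
      by (simp add: power2_eq_square power_divide power_mult_distrib)
    finally show ?thesis by simp
  qed
  ultimately show ?thesis by (simp add: mult_ac)
qed

text \<open>
  The sum is \<open>0F1(; a+1; - w\<^sup>2 D\<^sup>2 / 4) p\<close> at \<open>z\<close>. A finite truncation of the series need not
  have real roots in \<open>w D\<close>, so the half-plane bound comes from the approximations above, whose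
  images of \<open>p\<close> all have the degree and leading coefficient of \<open>p\<close>.
\<close>

theorem roots_bessel_op_in_half_plane:
  fixes p :: "complex poly"
  assumes "a > -1" and "p \<noteq> 0" and p: "\<And>\<zeta>. poly p \<zeta> = 0 \<Longrightarrow> Im (cnj w * \<zeta>) \<le> c"
    and zero: "(\<Sum>j\<le>degree p. (- w\<^sup>2) ^ j / of_real (4 ^ j * fact j * pochhammer (a + 1) j)
        * poly ((pderiv ^^ (2 * j)) p) z) = 0"
  shows "Im (cnj w * z) \<le> c"
proof (rule ccontr)
  assume "\<not> ?thesis"
  then have c: "Im (cnj w * z) > c" by simp
  define P where "P N = even_diff_op (of_real (1 / (2 * real N)) * w) (bessel_approx a N N) p" for N
  have "coeff (P N) (degree p) = lead_coeff p" for N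
    by (simp add: P_def coeff_degree_even_diff_op coeff_bessel_approx[OF \<open>a > -1\<close>])
  moreover from this have "degree (P N) = degree p" for N
    using degree_even_diff_op_le \<open>p \<noteq> 0\<close>
    by (metis P_def le_antisym le_degree leading_coeff_0_iff)
  moreover have "Im (cnj w * \<zeta>) \<le> c" if "poly (P N) \<zeta> = 0" for N \<zeta>
    by (rule roots_even_diff_op_in_half_plane[OF \<open>p \<noteq> 0\<close> p
          bessel_approx_roots(1)[OF \<open>a > -1\<close>] bessel_approx_roots(2)[OF \<open>a > -1\<close>]
          that[unfolded P_def]])
  ultimately have "norm (lead_coeff p) * (Im (cnj w * z) - c) ^ degree p
      \<le> norm w ^ degree p * norm (poly (P N) z)" for N
    using norm_poly_ge_power_of_depth[of "P N" w c z] c by simp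
  moreover have "(\<lambda>N. norm w ^ degree p * norm (poly (P N) z)) \<longlonglongrightarrow> norm w ^ degree p * norm (0::complex)"
  proof (intro tendsto_intros)
    have "(\<lambda>N. poly (P N) z) \<longlonglongrightarrow> (\<Sum>j\<le>degree p.
        (- w\<^sup>2) ^ j / of_real (4 ^ j * fact j * pochhammer (a + 1) j) * poly ((pderiv ^^ (2 * j)) p) z)"
      unfolding P_def even_diff_op_def poly_sum poly_smult
      by (intro tendsto_sum tendsto_mult tendsto_const tendsto_bessel_approx \<open>a > -1\<close>)
    then show "(\<lambda>N. poly (P N) z) \<longlonglongrightarrow> 0" by (simp only: zero)
  qed
  ultimately have "norm (lead_coeff p) * (Im (cnj w * z) - c) ^ degree p \<le> 0"
    by (intro LIMSEQ_le_const) auto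
  moreover have "norm (lead_coeff p) * (Im (cnj w * z) - c) ^ degree p > 0"
    using c \<open>p \<noteq> 0\<close> by simp
  ultimately show False by simp
qed

section \<open>The recurrence of the ultraspherical polynomials\<close>

text \<open>
  The equation \<open>(1 + t) b' = a b\<close> of the binomial series, carried through the composition that
  defines the power.
\<close>

lemma fps_deriv_fps_powr:
  assumes F: "fps_nth F 0 = [:c:]" "c > 0"
  shows "fps_deriv (fps_powr F a) * F = fps_const [:a:] * fps_deriv F * fps_powr F a"
proof -
  define b :: "real poly fps" where "b = Abs_fps (\<lambda>n. [:a gchoose n:])"
  define g where "g = fps_const [:1 / c:] * F - 1"
  define K :: "real poly fps" where "K = fps_const [:c powr a:]"
  have g0: "fps_nth g 0 = 0" using F by (simp add: g_def one_pCons)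
  have powr: "fps_powr F a = K * (b oo g)"
    using F by (simp add: fps_powr_def K_def b_def g_def)
  have "(1 + fps_X) * fps_deriv b = fps_const [:a:] * b"
  proof (rule fps_ext)
    fix n
    have "fps_nth ((1 + fps_X) * fps_deriv b) n =
        [:of_nat n * (a gchoose n) + of_nat (Suc n) * (a gchoose Suc n):]"
      by (cases n) (simp_all add: b_def distrib_right of_nat_poly one_pCons algebra_simps)
    also have "of_nat n * (a gchoose n) + of_nat (Suc n) * (a gchoose Suc n) = a * (a gchoose n)"
      by (rule gbinomial_mult_1[symmetric])
    finally show "fps_nth ((1 + fps_X) * fps_deriv b) n = fps_nth (fps_const [:a:] * b) n"
      by (simp add: b_def)
  qed
  then have "((1 + fps_X) * fps_deriv b) oo g = (fps_const [:a:] * b) oo g" by simp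
  then have ode: "(1 + g) * (fps_deriv b oo g) = fps_const [:a:] * (b oo g)"
    using g0 by (simp add: fps_compose_mult_distrib fps_compose_add_distrib)
  have g: "fps_const [:1 / c:] * F = 1 + g" by (simp add: g_def)
  have "fps_deriv (fps_powr F a) * F = K * (fps_deriv b oo g) * fps_deriv g * F"
    using g0 by (simp add: powr fps_compose_deriv K_def)
  also have "fps_deriv g = fps_const [:1 / c:] * fps_deriv F"
    by (simp add: g_def)
  also have "K * (fps_deriv b oo g) * (fps_const [:1 / c:] * fps_deriv F) * F =
      K * fps_deriv F * ((fps_const [:1 / c:] * F) * (fps_deriv b oo g))"
    by (simp only: mult_ac)
  also have "\<dots> = fps_const [:a:] * fps_deriv F * fps_powr F a"
    unfolding g ode powr by (simp only: mult_ac)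
  finally show ?thesis .
qed

lemma jacobi_rho_deriv: "jacobi_rho * fps_deriv jacobi_rho = fps_X - fps_const [:0, 1:]"
proof -
  have "2 * (jacobi_rho * fps_deriv jacobi_rho) = fps_deriv (jacobi_rho\<^sup>2)"
    by (simp add: power2_eq_square algebra_simps)
  also have "\<dots> = 2 * (fps_X - fps_const [:0, 1:])"
    unfolding jacobi_rho_squared by (simp add: power2_eq_square algebra_simps)
  finally show ?thesis by (metis mult_left_cancel zero_neq_numeral)
qed

text \<open>
  Division by \<open>\<rho>\<close> is avoided by a second unknown \<open>M = \<rho> G\<close>: the pair satisfies a linear system
  whose coefficients are polynomials in \<open>x\<close> and \<open>t\<close>. The product
  \<open>(1 + t + \<rho>) (1 - t + \<rho>) = 2 (1 - x t + \<rho>)\<close> makes this possible in the case of equal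
  parameters, because \<open>W = 1 - x t + \<rho>\<close> satisfies \<open>t \<rho> W' = (\<rho> - 1) W\<close>.
\<close>

lemma ultraspherical_gf_system:
  defines "x \<equiv> fps_const [:0, 1:] :: real poly fps" and "q \<equiv> jacobi_rho\<^sup>2"
  fixes \<alpha> :: real
  defines "a \<equiv> fps_const [:\<alpha>:] :: real poly fps" and "G \<equiv> jacobi_gf \<alpha> \<alpha>"
  defines "M \<equiv> jacobi_rho * G"
  shows "fps_X * fps_deriv M = a * G - a * M"
    and "q * (fps_X * fps_deriv G) = a * M - a * q * G - (fps_X\<^sup>2 - x * fps_X) * G"
proof -
  define r where "r = jacobi_rho"
  define U where "U = 1 + fps_X + r"
  define V where "V = 1 - fps_X + r"
  define W where "W = 1 - x * fps_X + r"
  define u where "u = fps_powr U (- \<alpha>)"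
  define v where "v = fps_powr V (- \<alpha>)"
  define K :: "real poly fps" where "K = fps_const [:2 powr (\<alpha> + \<alpha>):]"
  have r0: "fps_nth r 0 = [:1:]" by (simp add: r_def jacobi_rho_nth_0)
  have U0: "fps_nth U 0 = [:2:]" and V0: "fps_nth V 0 = [:2:]"
    by (simp_all add: U_def V_def r0 one_pCons)
  have "r * fps_powr r (-1) = 1"
    using fps_powr_add[OF r0, of 1 "-1"] fps_powr_1[OF r0] fps_powr_0[OF r0] by simp
  then have M: "M = K * (u * v)"
    by (simp add: M_def G_def jacobi_gf_def K_def u_def v_def U_def V_def r_def mult_ac)
  have q: "r * r = q" by (simp add: q_def r_def power2_eq_square)
  have q': "q = 1 - 2 * x * fps_X + fps_X\<^sup>2"
    by (simp add: q_def jacobi_rho_squared x_def)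
  have rr': "r * fps_deriv r = fps_X - x"
    by (simp add: r_def x_def jacobi_rho_deriv)
  have neg_a: "fps_const [:- \<alpha>:] = - a" by (simp add: a_def)
  have u': "fps_deriv u * U = - a * fps_deriv U * u"
    using fps_deriv_fps_powr[OF U0 zero_less_numeral, of "-\<alpha>"] unfolding u_def neg_a .
  have v': "fps_deriv v * V = - a * fps_deriv V * v"
    using fps_deriv_fps_powr[OF V0 zero_less_numeral, of "-\<alpha>"] unfolding v_def neg_a .
  have UV: "U * V = 2 * W"
    using q unfolding U_def V_def W_def q' by (simp add: algebra_simps power2_eq_square)
  have W0: "W \<noteq> 0" 
  proof
    assume "W = 0"
    then have "fps_nth W 0 = 0" by simp
    then show False by (simp add: W_def r0 one_pCons)
  qed
  have rn0: "r \<noteq> 0" using r0 by auto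
  have dW: "fps_deriv (U * V) = 2 * (fps_deriv r - x)"
    unfolding UV W_def x_def by simp
  \<comment> \<open>The factor \<open>U V = 2 W\<close> clears the denominators of the logarithmic derivative of \<open>M\<close>, and cancels at the end.\<close>
  have "2 * W * (fps_X * r * fps_deriv M) = fps_X * r * (fps_deriv M * (U * V))"
    unfolding UV by (simp only: mult_ac)
  also have "fps_deriv M * (U * V) = K * ((fps_deriv u * U) * V * v + (fps_deriv v * V) * U * u)"
    by (simp add: M K_def algebra_simps)
  also have "\<dots> = - a * M * fps_deriv (U * V)"
    unfolding u' v' M by (simp add: algebra_simps)
  also have "fps_X * r * (- a * M * fps_deriv (U * V)) =
     - (2 * a * M * (fps_X * (r * fps_deriv r) - x * fps_X * r))"
    unfolding dW by (simp add: algebra_simps)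
  also have "fps_X * (r * fps_deriv r) - x * fps_X * r = (r - 1) * W"
    using q unfolding rr' W_def q' by (simp add: algebra_simps power2_eq_square)
  finally have "2 * W * (fps_X * r * fps_deriv M) = 2 * W * (- (a * M * (r - 1)))"
    by (simp only: mult_ac mult_minus_right)
  then have rM': "fps_X * r * fps_deriv M = - (a * M * (r - 1))"
    using W0 by (metis mult_left_cancel mult_eq_0_iff zero_neq_numeral)
  then have "r * (fps_X * fps_deriv M) = r * (a * G - a * M)"
    by (simp add: M_def r_def algebra_simps)
  then show A: "fps_X * fps_deriv M = a * G - a * M"
    using rn0 by (metis mult_left_cancel)
  have "fps_deriv M = fps_deriv r * G + r * fps_deriv G"
    by (simp add: M_def r_def algebra_simps)
  then have "fps_X * r * fps_deriv M = fps_X * (r * fps_deriv r) * G + (r * r) * (fps_X * fps_deriv G)"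
    by (simp add: algebra_simps)
  then have "q * (fps_X * fps_deriv G) = - (a * M * (r - 1)) - fps_X * (fps_X - x) * G"
    unfolding rM' rr' q by (simp add: algebra_simps)
  also have "a * M * (r - 1) = a * (r * r) * G - a * M"
    by (simp add: M_def r_def algebra_simps)
  finally show "q * (fps_X * fps_deriv G) = a * M - a * q * G - (fps_X\<^sup>2 - x * fps_X) * G"
    unfolding q by (simp add: algebra_simps power2_eq_square)
qed

lemma
  fixes p q :: "real poly" and z :: complex
  shows poly_of_real_add: "poly (map_poly of_real (p + q)) z = poly (map_poly of_real p) z + poly (map_poly of_real q) z"
    and poly_of_real_diff: "poly (map_poly of_real (p - q)) z = poly (map_poly of_real p) z - poly (map_poly of_real q) z"
    and poly_of_real_smult: "poly (map_poly of_real (smult c p)) z = of_real c * poly (map_poly of_real p) z"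
    and poly_of_real_sum: "poly (map_poly of_real (\<Sum>i\<in>A. f i)) z = (\<Sum>i\<in>A. poly (map_poly of_real (f i)) z)"
proof -
  have add: "poly (map_poly of_real (p + q)) z = poly (map_poly of_real p) z + poly (map_poly of_real q) z"
    for p q :: "real poly"
  proof -
    have "map_poly of_real (p + q) = map_poly of_real p + (map_poly of_real q :: complex poly)"
      by (rule poly_eqI) (simp add: coeff_map_poly)
    then show ?thesis by simp
  qed
  show "poly (map_poly of_real (p + q)) z = poly (map_poly of_real p) z + poly (map_poly of_real q) z"
    by (rule add)
  show "poly (map_poly of_real (p - q)) z = poly (map_poly of_real p) z - poly (map_poly of_real q) z"
    using add[of "p - q" q] by simp
  show "poly (map_poly of_real (smult c p)) z = of_real c * poly (map_poly of_real p) z"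
    by (simp add: map_poly_smult)
  show "poly (map_poly of_real (\<Sum>i\<in>A. f i)) z = (\<Sum>i\<in>A. poly (map_poly of_real (f i)) z)"
    by (induction A rule: infinite_finite_induct) (auto simp: add)
qed

lemma fps_nth_X_mult_deriv: "fps_nth (fps_X * fps_deriv F) n = of_nat n * fps_nth F n"
  by (simp add: fps_mult_fps_X_deriv_shift)

lemma of_nat_times_poly: "(of_nat n :: real poly) * p = smult (real n) p"
  by (simp add: of_nat_poly)

text \<open>
  Eliminating \<open>M\<close> from the system leaves a recurrence for the coefficients of \<open>G\<close>. Its leading
  factor \<open>n (n + 2 \<alpha>)\<close> is positive for \<open>n \<ge> 2\<close> but vanishes for \<open>n = 1\<close>, \<open>\<alpha> = - 1/2\<close>; the first
  polynomial is therefore read off from \<open>M = \<rho> G\<close> directly.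
\<close>

lemma
  fixes \<alpha> :: real and z :: complex
  defines "g n \<equiv> poly (map_poly of_real (jacobi_poly n \<alpha> \<alpha>)) z"
  assumes "\<alpha> > -1"
  shows ultraspherical_0: "g 0 = 1"
    and ultraspherical_1: "g 1 = of_real (\<alpha> + 1) * z"
    and ultraspherical_recurrence:
      "of_real (real (n + 2) * (real (n + 2) + 2 * \<alpha>)) * g (n + 2) =
       of_real (real (n + 2) + \<alpha>) *
         (of_real (2 * real n + 3 + 2 * \<alpha>) * z * g (n + 1) - of_real (real n + 1 + \<alpha>) * g n)"
proof -
  define ev where "ev p = poly (map_poly complex_of_real p) z" for p
  define G where "G = jacobi_gf \<alpha> \<alpha>"
  define M where "M = jacobi_rho * G"
  define m where "m n = ev (fps_nth M n)" for n
  have g: "g n = ev (fps_nth G n)" for n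
    by (simp add: g_def ev_def G_def jacobi_poly_def)
  note ev_simps = poly_of_real_add[of _ _ z, folded ev_def] poly_of_real_diff[of _ _ z, folded ev_def]
    poly_of_real_smult[of _ _ z, folded ev_def]
  have ev_x: "ev (pCons 0 p) = z * ev p" for p
    by (simp add: ev_def map_poly_pCons)
  have G0: "fps_nth G 0 = 1"
  proof -
    have U: "fps_nth (1 + fps_X + jacobi_rho) 0 = [:2:]" and V: "fps_nth (1 - fps_X + jacobi_rho) 0 = [:2:]"
      by (simp_all add: jacobi_rho_nth_0 one_pCons)
    have "fps_nth G 0 = [:2 powr (\<alpha> + \<alpha>) * 2 powr (-\<alpha>) * 2 powr (-\<alpha>):]"
      by (simp add: G_def jacobi_gf_def fps_powr_nth_0[OF U] fps_powr_nth_0[OF V]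
          fps_powr_nth_0[OF jacobi_rho_nth_0] del: powr_minus)
    also have "2 powr (\<alpha> + \<alpha>) * 2 powr (-\<alpha>) * 2 powr (-\<alpha>) = (1::real)"
      by (simp flip: powr_add)
    finally show ?thesis by (simp add: one_pCons)
  qed
  then show g0: "g 0 = 1" by (simp add: g ev_def)
  have rho1: "fps_nth jacobi_rho 1 = [:0, -1:]"
  proof -
    have "fps_nth (jacobi_rho\<^sup>2) 1 = 2 * fps_nth jacobi_rho 1"
      by (simp add: power2_eq_square jacobi_rho_nth_0 one_pCons)
    moreover have "fps_nth (jacobi_rho\<^sup>2) 1 = 2 * [:0, -1:]"
      unfolding jacobi_rho_squared by (simp add: power2_eq_square numeral_poly)
    ultimately show ?thesis by (metis mult_left_cancel zero_neq_numeral)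
  qed
  have mA: "of_real (real n + \<alpha>) * m n = of_real \<alpha> * g n" for n
  proof -
    have "fps_nth (fps_X * fps_deriv M) n = smult \<alpha> (fps_nth G n) - smult \<alpha> (fps_nth M n)"
      unfolding M_def G_def ultraspherical_gf_system(1) by simp
    then have "smult (real n) (fps_nth M n) = smult \<alpha> (fps_nth G n) - smult \<alpha> (fps_nth M n)"
      by (simp only: fps_nth_X_mult_deriv of_nat_times_poly)
    from arg_cong[OF this, of ev] show ?thesis
      by (simp add: ev_simps m_def g algebra_simps)
  qed
  have "fps_nth M 1 = fps_nth G 1 + [:0, -1:]"
    by (simp add: M_def jacobi_rho_nth_0 rho1[simplified] G0)
  from arg_cong[OF this, of ev] have m1: "m 1 = g 1 - z"
    by (simp add: m_def g ev_simps ev_x ev_def[of "[:-1:]"] map_poly_pCons)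
  then show "g 1 = of_real (\<alpha> + 1) * z"
    using mA[of 1, unfolded m1] by (simp add: algebra_simps)
  have B: "of_real (real (n + 2)) * g (n + 2) - 2 * z * of_real (real (n + 1)) * g (n + 1)
      + of_real (real n) * g n = of_real \<alpha> * m (n + 2)
      - of_real \<alpha> * (g (n + 2) - 2 * z * g (n + 1) + g n) - g n + z * g (n + 1)"
  proof -
    define T where "T = fps_X * fps_deriv G"
    have T: "fps_nth T k = smult (real k) (fps_nth G k)" for k
      by (simp only: T_def fps_nth_X_mult_deriv of_nat_times_poly)
    have q: "fps_nth (jacobi_rho\<^sup>2 * F) (n + 2) =
        fps_nth F (n + 2) - smult 2 (pCons 0 (fps_nth F (n + 1))) + fps_nth F n" for F
    proof -
      have "jacobi_rho\<^sup>2 * F = F - fps_const [:0, 2:] * (fps_X * F) + fps_X * (fps_X * F)"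
        unfolding jacobi_rho_squared by (simp add: algebra_simps power2_eq_square numeral_fps_const numeral_poly)
      then show ?thesis by simp
    qed
    have "fps_nth (jacobi_rho\<^sup>2 * T) (n + 2) =
      fps_nth (fps_const [:\<alpha>:] * M - fps_const [:\<alpha>:] * (jacobi_rho\<^sup>2 * G)
        - (fps_X * (fps_X * G) - fps_const [:0, 1:] * (fps_X * G))) (n + 2)"
      unfolding T_def M_def G_def ultraspherical_gf_system(2) by (simp add: algebra_simps power2_eq_square)
    then have "fps_nth T (n + 2) - smult 2 (pCons 0 (fps_nth T (n + 1))) + fps_nth T n =
       smult \<alpha> (fps_nth M (n + 2)) - smult \<alpha>
         (fps_nth G (n + 2) - smult 2 (pCons 0 (fps_nth G (n + 1))) + fps_nth G n)
       - (fps_nth G n - pCons 0 (fps_nth G (n + 1)))"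
      unfolding fps_sub_nth q fps_mult_left_const_nth by simp
    from arg_cong[OF this, of ev] show ?thesis
      by (simp only: ev_simps ev_x T m_def g) (simp add: algebra_simps)
  qed
  have mA2: "of_real (real (n + 2) + \<alpha>) * m (n + 2) = of_real \<alpha> * g (n + 2)" by (rule mA)
  have alg: "N * (N + 2 * b) * g2 = (N + b) * ((2 * N - 1 + 2 * b) * z * g1 - (N - 1 + b) * gn)"
    if "(N + b) * m2 = b * g2"
      "N * g2 - 2 * z * (N - 1) * g1 + (N - 2) * gn =
        b * m2 - b * (g2 - 2 * z * g1 + gn) - gn + z * g1"
    for N b g2 g1 gn m2 :: complex
    using that by algebra
  have "complex_of_real (real n) = complex_of_real (real (n + 2)) - 2"
     "complex_of_real (real (n + 1)) = complex_of_real (real (n + 2)) - 1" by simp_all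
  then show "of_real (real (n + 2) * (real (n + 2) + 2 * \<alpha>)) * g (n + 2) =
       of_real (real (n + 2) + \<alpha>) *
         (of_real (2 * real n + 3 + 2 * \<alpha>) * z * g (n + 1) - of_real (real n + 1 + \<alpha>) * g n)"
    using alg[of "of_real (real (n + 2))" "of_real \<alpha>" "m (n + 2)" "g (n + 2)" "g (n + 1)" "g n"]
      mA2 B by (simp add: algebra_simps)
qed

section \<open>Explicit ultraspherical polynomials\<close>

text \<open>
  The coefficient of \<open>t\<^sup>n\<close> in \<open>e\<^sup>z\<^sup>t 0F1(; \<alpha>+1; (z\<^sup>2 - 1) t\<^sup>2 / 4)\<close>, which is the \<open>n\<close>-th ultraspherical
  polynomial divided by \<open>(\<alpha>+1)\<^sub>n\<close>.
\<close>

definition ultraspherical_sum :: "real \<Rightarrow> complex \<Rightarrow> nat \<Rightarrow> complex" where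
  "ultraspherical_sum \<alpha> z n = (\<Sum>j | 2 * j \<le> n.
     (z\<^sup>2 - 1) ^ j / of_real (4 ^ j * fact j * pochhammer (\<alpha> + 1) j) * (z ^ (n - 2 * j) / fact (n - 2 * j)))"

text \<open>
  With \<open>\<theta> = t d/dt\<close>, the Bessel equation \<open>\<theta> (\<theta> + 2 \<alpha>) B = (z\<^sup>2 - 1) t\<^sup>2 B\<close> becomes, for \<open>Y = e\<^sup>z\<^sup>t B\<close>,
  the equation \<open>\<theta> (\<theta> + 2 \<alpha>) Y = z t (2 \<theta> + 2 \<alpha> + 1) Y - t\<^sup>2 Y\<close>: the terms \<open>z\<^sup>2 t\<^sup>2\<close> cancel. The
  recurrence compares coefficients.
\<close>

lemma ultraspherical_sum_recurrence:
  fixes \<alpha> :: real and z :: complex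
  assumes "\<alpha> > -1"
  defines "s \<equiv> ultraspherical_sum \<alpha> z"
  shows "s 0 = 1" and "s 1 = z"
    and "of_real (real (n + 2) * (real (n + 2) + 2 * \<alpha>)) * s (n + 2) =
      of_real (2 * real n + 3 + 2 * \<alpha>) * z * s (n + 1) - s n"
proof -
  define d :: "nat \<Rightarrow> complex" where "d j = of_real (4 ^ j * fact j * pochhammer (\<alpha> + 1) j)" for j
  define b where "b = complex_of_real \<alpha>"
  define B where "B = Abs_fps (\<lambda>i. if even i then (z\<^sup>2 - 1) ^ (i div 2) / d (i div 2) else 0)"
  define E where "E = fps_exp z"
  define Y where "Y = B * E"
  have s: "s n = fps_nth Y n" for n
  proof -
    have "fps_nth Y n = (\<Sum>i = 0..n. fps_nth B i * fps_nth E (n - i))"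
      by (simp add: Y_def fps_mult_nth)
    also have "\<dots> = (\<Sum>i | i \<le> n \<and> even i. fps_nth B i * fps_nth E (n - i))"
      by (rule sum.mono_neutral_right) (auto simp: B_def)
    also have "\<dots> = s n"
      unfolding s_def ultraspherical_sum_def
      by (rule sum.reindex_bij_witness[of _ "\<lambda>j. 2 * j" "\<lambda>i. i div 2"]) (auto simp: B_def E_def d_def)
    finally show ?thesis ..
  qed
  have "{j. 2 * j \<le> 1} = {0::nat}" by auto
  then show "s 0 = 1" and "s 1 = z" by (simp_all add: s_def ultraspherical_sum_def)
  have bessel: "fps_X * (fps_X * fps_deriv (fps_deriv B)) + fps_const (1 + 2 * b) * (fps_X * fps_deriv B)
      = fps_const (z\<^sup>2 - 1) * (fps_X * (fps_X * B))" (is "?L = ?R")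
  proof (rule fps_ext)
    fix i :: nat
    have L: "fps_nth ?L i = of_nat i * (of_nat i + 2 * b) * fps_nth B i"
      by (cases i; cases "i - 1") (simp_all add: algebra_simps)
    show "fps_nth ?L i = fps_nth ?R i"
    proof (cases "even i \<and> i > 0")
      case True
      then obtain j where i: "i = 2 * Suc j" by (metis evenE gr0_conv_Suc mult_0_right neq0_conv)
      have p: "pochhammer (\<alpha> + 1) j > 0" using assms by (intro pochhammer_pos) simp
      have "\<alpha> + 1 + real j > 0" using assms by simp
      then have nz: "b + 1 + of_nat j \<noteq> 0"
        unfolding b_def by (metis of_real_eq_0_iff of_real_add of_real_1 of_real_of_nat_eq less_irrefl)
      have dS: "d (Suc j) = of_nat i * (of_nat i + 2 * b) * d j"
        by (simp add: d_def b_def i pochhammer_Suc algebra_simps)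
      have "d j \<noteq> 0" using p by (simp add: d_def)
      moreover have "of_nat i * (of_nat i + 2 * b) \<noteq> 0"
      proof -
        have "of_nat i + 2 * b = 2 * (b + 1 + of_nat j)" by (simp add: i)
        moreover have "of_nat i \<noteq> (0 :: complex)" by (simp only: of_nat_eq_0_iff) (simp add: i)
        ultimately show ?thesis using nz by (simp only: mult_eq_0_iff) simp
      qed
      ultimately have "fps_nth ?L i = (z\<^sup>2 - 1) ^ Suc j / d j"
        unfolding L by (simp add: B_def i dS[unfolded i] del: of_nat_Suc power_Suc mult_Suc_right)
      also have "\<dots> = fps_nth ?R i" by (simp add: i B_def)
      finally show ?thesis .
    next
      case False
      then have "odd i \<or> i = 0" by auto
      then show ?thesis unfolding L
        by (cases i; cases "i - 1") (auto simp: B_def)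
    qed
  qed
  have E': "fps_deriv E = fps_const z * E" by (simp add: E_def)
  have Y': "fps_deriv Y = E * (fps_const z * B + fps_deriv B)"
    by (simp add: Y_def E' algebra_simps)
  have Y'': "fps_deriv (fps_deriv Y) =
      E * (fps_const z * fps_const z * B + 2 * fps_const z * fps_deriv B + fps_deriv (fps_deriv B))"
    unfolding Y' by (simp add: E' algebra_simps)
  have ode: "fps_X * (fps_X * fps_deriv (fps_deriv Y)) + fps_const (1 + 2 * b) * (fps_X * fps_deriv Y)
     = fps_const (2 * z) * (fps_X * (fps_X * fps_deriv Y))
       + fps_const ((1 + 2 * b) * z) * (fps_X * Y) - fps_X * (fps_X * Y)"
  proof -
    have "fps_X * (fps_X * fps_deriv (fps_deriv Y)) + fps_const (1 + 2 * b) * (fps_X * fps_deriv Y) =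
      E * (?L + fps_X * fps_X * (fps_const z * fps_const z * B + 2 * fps_const z * fps_deriv B)
         + fps_const (1 + 2 * b) * fps_X * fps_const z * B)"
      by (subst Y'', subst Y') (simp only: algebra_simps)
    also have "\<dots> = fps_const (2 * z) * (fps_X * (fps_X * fps_deriv Y))
       + fps_const ((1 + 2 * b) * z) * (fps_X * Y) - fps_X * (fps_X * Y)"
      unfolding bessel Y' unfolding Y_def
      by (simp add: algebra_simps power2_eq_square numeral_fps_const flip: fps_const_mult fps_const_sub fps_const_add)
    finally show ?thesis .
  qed
  have "of_nat (n + 2) * (of_nat (n + 2) + 2 * b) * fps_nth Y (n + 2) =
     (2 * of_nat n + 3 + 2 * b) * z * fps_nth Y (n + 1) - fps_nth Y n"
    using arg_cong[OF ode, of "\<lambda>F. fps_nth F (n + 2)"] by (simp add: algebra_simps)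
  then show "of_real (real (n + 2) * (real (n + 2) + 2 * \<alpha>)) * s (n + 2) =
      of_real (2 * real n + 3 + 2 * \<alpha>) * z * s (n + 1) - s n"
    by (simp add: s b_def)
qed

text \<open>
  Both sides satisfy the same three-term recurrence: \<open>(\<alpha>+1)\<^sub>n\<^sub>+\<^sub>2\<close> contains the factors
  \<open>n + 2 + \<alpha>\<close> and \<open>n + 1 + \<alpha>\<close> that distinguish the recurrences of the two normalisations.
\<close>

lemma poly_ultraspherical:
  assumes "\<alpha> > -1"
  shows "poly (map_poly of_real (jacobi_poly n \<alpha> \<alpha>)) z =
    of_real (pochhammer (\<alpha> + 1) n) * ultraspherical_sum \<alpha> z n"
proof (induction n rule: less_induct)
  case (less n)
  consider "n = 0" | "n = 1" | k where "n = k + 2"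
    by (metis One_nat_def add_2_eq_Suc' not0_implies_Suc)
  then show ?case
  proof cases
    case 1
    then show ?thesis
      using ultraspherical_0[OF assms, of z] ultraspherical_sum_recurrence(1)[OF assms] by simp
  next
    case 2
    then show ?thesis
      using ultraspherical_1[OF assms, of z] ultraspherical_sum_recurrence(2)[OF assms] by simp
  next
    case (3 k)
    define g where "g m = poly (map_poly of_real (jacobi_poly m \<alpha> \<alpha>)) z" for m
    define s where "s = ultraspherical_sum \<alpha> z"
    define p where "p m = complex_of_real (pochhammer (\<alpha> + 1) m)" for m
    define N where "N = complex_of_real (real (k + 2) * (real (k + 2) + 2 * \<alpha>))"
    define u where "u = complex_of_real (2 * real k + 3 + 2 * \<alpha>)"
    have "real (k + 2) * (real (k + 2) + 2 * \<alpha>) > 0"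
      using assms by (intro mult_pos_pos) auto
    then have N: "N \<noteq> 0" unfolding N_def by (metis of_real_eq_0_iff less_irrefl)
    have IH: "g (k + 1) = p (k + 1) * s (k + 1)" "g k = p k * s k"
      using less.IH[of "k + 1"] less.IH[of k] by (simp_all add: 3 g_def p_def s_def)
    have "N * g (k + 2) = of_real (real (k + 2) + \<alpha>) *
        (u * z * g (k + 1) - of_real (real k + 1 + \<alpha>) * g k)"
      unfolding g_def N_def u_def by (rule ultraspherical_recurrence[OF assms])
    also have "\<dots> = p (k + 2) * (u * z * s (k + 1) - s k)"
      unfolding IH by (simp add: p_def pochhammer_Suc algebra_simps)
    also have "u * z * s (k + 1) - s k = N * s (k + 2)"
      unfolding u_def N_def s_def by (rule ultraspherical_sum_recurrence(3)[OF assms, symmetric])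
    finally have "g (k + 2) = p (k + 2) * s (k + 2)" using N by simp
    then show ?thesis by (simp add: 3 g_def p_def s_def)
  qed
qed

lemma higher_pderiv_monom_one:
  "(pderiv ^^ m) (monom (1 :: 'a :: field_char_0) k) = (if m \<le> k then monom (fact k / fact (k - m)) (k - m) else 0)"
proof (induction m)
  case (Suc m)
  show ?case
  proof (cases "Suc m \<le> k")
    case True
    then have "k - m = Suc (k - Suc m)" by simp
    then have "fact (k - m) = of_nat (k - m) * (fact (k - Suc m) :: 'a)"
      by (simp only: fact_Suc of_nat_mult)
    then show ?thesis using True by (simp add: Suc.IH pderiv_monom)
  next
    case False
    then show ?thesis by (auto simp: Suc.IH pderiv_monom pderiv_0)
  qed
qed auto

text \<open>
  The factor \<open>n!\<close> turns \<open>z\<^sup>n\<^sup>-\<^sup>2\<^sup>j / (n - 2 j)!\<close> into a derivative of \<open>z\<^sup>n\<close>. The number of terms is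
  an arbitrary \<open>N \<ge> n\<close> so that the sums for different monomials can be added.
\<close>

lemma fact_times_ultraspherical_sum:
  assumes "n \<le> N"
  shows "fact n * ultraspherical_sum \<alpha> z n =
    (\<Sum>j\<le>N. (z\<^sup>2 - 1) ^ j / of_real (4 ^ j * fact j * pochhammer (\<alpha> + 1) j)
      * poly ((pderiv ^^ (2 * j)) (monom 1 n)) z)"
proof -
  have "fact n * ultraspherical_sum \<alpha> z n = (\<Sum>j | 2 * j \<le> n.
     (z\<^sup>2 - 1) ^ j / of_real (4 ^ j * fact j * pochhammer (\<alpha> + 1) j)
      * poly ((pderiv ^^ (2 * j)) (monom 1 n)) z)"
    unfolding ultraspherical_sum_def sum_distrib_left
    by (intro sum.cong) (auto simp: higher_pderiv_monom_one poly_monom)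
  also have "\<dots> = (\<Sum>j\<le>N. (z\<^sup>2 - 1) ^ j / of_real (4 ^ j * fact j * pochhammer (\<alpha> + 1) j)
      * poly ((pderiv ^^ (2 * j)) (monom 1 n)) z)"
    using assms by (intro sum.mono_neutral_left) (auto simp: higher_pderiv_monom_one)
  finally show ?thesis .
qed

section \<open>Zeros of ultraspherical sums\<close>

text \<open>
  For nonreal \<open>w\<close> write \<open>z = \<kappa> + t w\<close> with real \<open>\<kappa>\<close> and \<open>t\<close>; the strip condition says
  \<open>\<bar>\<kappa>\<bar> < 1\<close>. Then \<open>z\<^sup>2 + w\<^sup>2 = 1\<close> is a real quadratic equation for \<open>w\<close> with discriminant
  \<open>4 (1 + t\<^sup>2 - \<kappa>\<^sup>2) > 0\<close>, so \<open>w\<close> would be real after all. For real \<open>w \<noteq> 0\<close> the strip is the real line and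
  \<open>z\<^sup>2 = 1 - w\<^sup>2 < 1\<close>.
\<close>

lemma real_of_strip_and_circle:
  fixes z w :: complex
  assumes circle: "z\<^sup>2 + w\<^sup>2 = 1" and "w \<noteq> 0"
    and strip: "\<bar>Im (cnj w * z)\<bar> \<le> k * \<bar>Im w\<bar>" and "k < 1"
  shows "\<exists>r. z = of_real r \<and> -1 < r \<and> r < 1"
proof (cases "Im w = 0")
  case True
  have "Re w \<noteq> 0" using True \<open>w \<noteq> 0\<close> by (simp add: complex_eq_iff)
  moreover from strip have "Re w * Im z = 0" by (simp add: True)
  ultimately have z: "Im z = 0" by simp
  have "(Re z)\<^sup>2 + (Re w)\<^sup>2 = 1"
    using arg_cong[OF circle, of Re] by (simp add: True z Re_power2)
  then have "(Re z)\<^sup>2 < 1"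
    using \<open>Re w \<noteq> 0\<close> by (smt (verit) zero_less_power2)
  then have "\<bar>Re z\<bar> < 1" by (simp add: abs_square_less_1)
  moreover have "z = of_real (Re z)" using z by (simp add: complex_eq_iff)
  ultimately show ?thesis by (intro exI[of _ "Re z"]) auto
next
  case False
  define t where "t = Im z / Im w"
  define \<kappa> where "\<kappa> = - Im (cnj w * z) / Im w"
  have y: "Im z = t * Im w" using False by (simp add: t_def)
  have x: "Re z = \<kappa> + t * Re w" using False by (simp add: \<kappa>_def t_def field_simps)
  have "\<bar>\<kappa>\<bar> \<le> k" using strip False by (simp add: \<kappa>_def abs_divide divide_le_eq)
  then have "\<bar>\<kappa>\<bar> < 1" using \<open>k < 1\<close> by linarith
  then have \<kappa>: "\<kappa>\<^sup>2 < 1" by (simp add: abs_square_less_1)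
  have re: "(\<kappa> + t * Re w)\<^sup>2 - (t * Im w)\<^sup>2 + ((Re w)\<^sup>2 - (Im w)\<^sup>2) = 1"
    using arg_cong[OF circle, of Re] by (simp add: Re_power2 x y)
  have "Im w * ((\<kappa> + t * Re w) * t + Re w) = 0"
    using arg_cong[OF circle, of Im] by (simp add: Im_power2 x y algebra_simps)
  then have im: "(\<kappa> + t * Re w) * t + Re w = 0" using False by simp
  have "\<kappa>\<^sup>2 - (1 + t\<^sup>2)\<^sup>2 * (Im w)\<^sup>2 = 1 + t\<^sup>2"
    using re im by algebra
  moreover have "(1 + t\<^sup>2)\<^sup>2 * (Im w)\<^sup>2 \<ge> 0" "t\<^sup>2 \<ge> 0" by simp_all
  ultimately show ?thesis using \<kappa> by linarith
qed

theorem theorem1p2: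
  fixes \<alpha> :: real and n :: nat and a :: "nat \<Rightarrow> real" and f :: "real poly"
  assumes "\<alpha> > -1"
    and "f = (\<Sum>k=0..n. monom (a k) k)"
    and "all_zeros_in_unit_interval f"
  shows "all_zeros_in_unit_interval
    (\<Sum>k=0..n. smult (a k * (fact k / Gamma (real k + 1 + \<alpha>))) (jacobi_poly k \<alpha> \<alpha>))"
  unfolding all_zeros_in_unit_interval_def
proof (intro allI impI)
  fix z :: complex
  assume zero: "poly (map_poly complex_of_real
    (\<Sum>k=0..n. smult (a k * (fact k / Gamma (real k + 1 + \<alpha>))) (jacobi_poly k \<alpha> \<alpha>))) z = 0"
  define p where "p = map_poly complex_of_real f"
  define d where "d j = complex_of_real (4 ^ j * fact j * pochhammer (\<alpha> + 1) j)" for j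
  have roots: "\<exists>r. \<zeta> = of_real r \<and> -1 < r \<and> r < 1" if "poly p \<zeta> = 0" for \<zeta>
    using assms(3) that by (auto simp: all_zeros_in_unit_interval_def p_def)
  have "p \<noteq> 0"
  proof
    assume "p = 0"
    then obtain r where "2 = complex_of_real r" "r < 1" using roots[of 2] by auto
    then show False by (metis of_real_eq_iff of_real_numeral not_numeral_less_one)
  qed
  have p: "p = (\<Sum>k=0..n. smult (of_real (a k)) (monom 1 k))"
    by (rule poly_eqI) (simp add: p_def assms(2) coeff_map_poly coeff_sum if_distrib cong: if_cong)
  have deg: "degree p \<le> n"
    unfolding p by (intro degree_sum_le) (auto intro!: order.trans[OF degree_smult_le] simp: degree_monom_eq)
  have Gamma_nz: "Gamma (\<alpha> + 1) \<noteq> 0" "\<alpha> + 1 \<notin> \<int>\<^sub>\<le>\<^sub>0"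
    using assms(1) by (auto simp: Gamma_eq_zero_iff elim!: nonpos_Ints_cases)
  have coeff: "(fact k / Gamma (real k + 1 + \<alpha>)) * pochhammer (\<alpha> + 1) k = fact k / Gamma (\<alpha> + 1)" for k
  proof -
    have "Gamma (real k + 1 + \<alpha>) \<noteq> 0"
      using assms(1) by (intro less_imp_neq[THEN not_sym] Gamma_real_pos) simp
    then show ?thesis
      using pochhammer_Gamma[OF Gamma_nz(2), of k] by (simp add: add_ac)
  qed
  have term_eq: "of_real (a k * (fact k / Gamma (real k + 1 + \<alpha>))) * (of_real (pochhammer (\<alpha> + 1) k) * s)
     = of_real (1 / Gamma (\<alpha> + 1)) * (of_real (a k) * (fact k * s))" for k and s :: complex
  proof -
    have "of_real (a k * (fact k / Gamma (real k + 1 + \<alpha>))) * (of_real (pochhammer (\<alpha> + 1) k) * s)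
     = of_real (a k * ((fact k / Gamma (real k + 1 + \<alpha>)) * pochhammer (\<alpha> + 1) k)) * s"
      by (simp only: of_real_mult mult.assoc)
    then show ?thesis unfolding coeff by simp
  qed
  have "of_real (1 / Gamma (\<alpha> + 1)) *
      (\<Sum>k=0..n. of_real (a k) * (fact k * ultraspherical_sum \<alpha> z k)) = 0"
    using zero
    by (simp only: poly_of_real_sum poly_of_real_smult poly_ultraspherical[OF assms(1)] term_eq sum_distrib_left)
  then have "(\<Sum>k=0..n. of_real (a k) * (fact k * ultraspherical_sum \<alpha> z k)) = 0"
    using Gamma_nz by simp
  also have "(\<Sum>k=0..n. of_real (a k) * (fact k * ultraspherical_sum \<alpha> z k)) =
      (\<Sum>k=0..n. of_real (a k) * (\<Sum>j\<le>n. (z\<^sup>2 - 1) ^ j / d j * poly ((pderiv ^^ (2 * j)) (monom 1 k)) z))"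
    unfolding d_def by (intro sum.cong refl arg_cong2[of _ _ _ _ "(*)"] fact_times_ultraspherical_sum) simp
  also have "\<dots> = (\<Sum>j\<le>n. (z\<^sup>2 - 1) ^ j / d j *
      (\<Sum>k=0..n. of_real (a k) * poly ((pderiv ^^ (2 * j)) (monom 1 k)) z))"
    unfolding sum_distrib_left by (subst sum.swap) (simp only: mult.left_commute)
  also have "\<dots> = (\<Sum>j\<le>n. (z\<^sup>2 - 1) ^ j / d j * poly ((pderiv ^^ (2 * j)) p) z)"
    by (simp add: p higher_pderiv_sum higher_pderiv_smult poly_sum)
  also have "\<dots> = (\<Sum>j\<le>degree p. (z\<^sup>2 - 1) ^ j / d j * poly ((pderiv ^^ (2 * j)) p) z)"
    using deg by (intro sum.mono_neutral_right) (auto simp: higher_pderiv_eq_0)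
  finally have F: "(\<Sum>j\<le>degree p. (z\<^sup>2 - 1) ^ j / d j * poly ((pderiv ^^ (2 * j)) p) z) = 0" .
  define w where "w = csqrt (1 - z\<^sup>2)"
  have w: "- w\<^sup>2 = z\<^sup>2 - 1" by (simp add: w_def)
  show "\<exists>r. z = of_real r \<and> -1 < r \<and> r < 1"
  proof (cases "w = 0")
    case True
    \<comment> \<open>Here \<open>z = 1\<close> or \<open>z = -1\<close>, and only the term without derivatives remains.\<close>
    then have sq: "z\<^sup>2 - 1 = 0" using w by simp
    have "poly p z = (\<Sum>j\<le>degree p. if j = 0 then poly p z else 0)" by simp
    also have "\<dots> = (\<Sum>j\<le>degree p. (z\<^sup>2 - 1) ^ j / d j * poly ((pderiv ^^ (2 * j)) p) z)"
      unfolding sq by (intro sum.cong) (auto simp: d_def)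
    finally show ?thesis by (intro roots) (simp only: F)
  next
    case False
    define k where "k = Max (insert 0 (norm ` {\<zeta>. poly p \<zeta> = 0}))"
    have fin: "finite {\<zeta>. poly p \<zeta> = 0}" using \<open>p \<noteq> 0\<close> by (rule poly_roots_finite)
    have "norm \<zeta> < 1" if "poly p \<zeta> = 0" for \<zeta> using roots[OF that] by auto
    then have "k < 1" using fin by (auto simp: k_def)
    have k: "norm \<zeta> \<le> k" if "poly p \<zeta> = 0" for \<zeta>
      using fin that by (auto simp: k_def intro!: Max_ge)
    have strip: "\<bar>Im (cnj v * \<zeta>)\<bar> \<le> k * \<bar>Im v\<bar>" if \<zeta>: "poly p \<zeta> = 0" for \<zeta> v
    proof -
      obtain r where r: "\<zeta> = of_real r" using roots[OF \<zeta>] by blast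
      then have "\<bar>Im (cnj v * \<zeta>)\<bar> = \<bar>r\<bar> * \<bar>Im v\<bar>" by (simp add: abs_mult)
      also have "\<dots> \<le> k * \<bar>Im v\<bar>" using k[OF \<zeta>] r by (intro mult_right_mono) auto
      finally show ?thesis .
    qed
    \<comment> \<open>The strip is the intersection of two half-planes, one for each square root of \<open>1 - z\<^sup>2\<close>.\<close>
    have bound: "Im (cnj v * z) \<le> k * \<bar>Im v\<bar>" if "- v\<^sup>2 = z\<^sup>2 - 1" for v
    proof (rule roots_bessel_op_in_half_plane[OF assms(1) \<open>p \<noteq> 0\<close>])
      show "Im (cnj v * \<zeta>) \<le> k * \<bar>Im v\<bar>" if "poly p \<zeta> = 0" for \<zeta>
        using strip[OF that, of v] by linarith
      show "(\<Sum>j\<le>degree p. (- v\<^sup>2) ^ j / of_real (4 ^ j * fact j * pochhammer (\<alpha> + 1) j)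
        * poly ((pderiv ^^ (2 * j)) p) z) = 0"
        using F by (simp only: d_def that)
    qed
    have "\<bar>Im (cnj w * z)\<bar> \<le> k * \<bar>Im w\<bar>"
      using bound[of w] bound[of "-w"] w by (simp add: abs_le_iff)
    then show ?thesis
      using real_of_strip_and_circle[of z w k] False w \<open>k < 1\<close> by (simp add: algebra_simps w_def)
  qed
qed

end
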